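(* Let $n\geq 1$ and let $E_1,E_2$ be $n\times n$ Erdős matrices. (a) If $\operatorname{skel}(E_1)<\operatorname{skel}(E_2)$, then $\operatorname{maxtrace}(E_1)>\operatorname{maxtrace}(E_2)$. (b) If $\operatorname{skel}(E_1)=\operatorname{skel}(E_2)$, then $E_1=E_2$.
   Context: A real $n\times n$ matrix is bistochastic if all its entries lie in $[0,1]$ and every row sum and column sum equals $1$. Let $P_n$ denote the set of $n\times n$ permutation matrices. For an $n\times n$ matrix $M$ and $\sigma\in P_n$, the $\sigma$-trace is $\operatorname{tr}_\sigma(M)=\operatorname{tr}(\sigma^T M)$, and $\operatorname{maxtrace}(M)=\max_{\sigma\in P_n}\operatorname{tr}_\sigma(M)$. The squared Frobenius norm is $\|M\|_F^2=\sum_{i,j}M_{i,j}^2$. A bistochastic matrix $E$ is an Erdős matrix if $\operatorname{maxtrace}(E)=\|E\|_F^2$. The skeleton $\operatorname{skel}(M)$ of $M$ is the $0/1$ matrix with $\operatorname{skel}(M)_{i,j}=1$ iff $M_{i,j}\neq 0$. For $0/1$ matrices $S_1,S_2$ of the same size, $S_1\leq S_2$ means $S_2-S_1$ is also a $0/1$ matrix; $S_1<S_2$ means $S_1\leq S_2$ and $S_1\neq S_2$. *)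

theory Defs
  imports "HOL-Analysis.Analysis"
begin

text \<open>Square matrices of size \<open>n \<ge> 1\<close> are elements of \<open>real ^ 'n ^ 'n\<close>, with \<open>n = CARD('n)\<close>.\<close>

definition bistochastic :: "real ^ 'n ^ 'n \<Rightarrow> bool" where
  "bistochastic M \<longleftrightarrow>
     (\<forall>i j. 0 \<le> M $ i $ j \<and> M $ i $ j \<le> 1) \<and>
     (\<forall>i. (\<Sum>j\<in>UNIV. M $ i $ j) = 1) \<and>
     (\<forall>j. (\<Sum>i\<in>UNIV. M $ i $ j) = 1)"

definition perm_matrix :: "('n \<Rightarrow> 'n) \<Rightarrow> real ^ 'n ^ 'n" where
  "perm_matrix p = (\<chi> i j. if j = p i then 1 else 0)"

definition perm_matrices :: "(real ^ 'n ^ 'n) set" where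
  "perm_matrices = perm_matrix ` {p. p permutes UNIV}"

definition sigma_trace :: "real ^ 'n ^ 'n \<Rightarrow> real ^ 'n ^ 'n \<Rightarrow> real" where
  "sigma_trace S M = trace (transpose S ** M)"

definition maxtrace :: "real ^ 'n ^ 'n \<Rightarrow> real" where
  "maxtrace M = Max ((\<lambda>S. sigma_trace S M) ` perm_matrices)"

text \<open>The following two facts make the maximum in \<open>maxtrace\<close> a genuine one.\<close>

lemma finite_perm_matrices: "finite (perm_matrices :: (real ^ 'n ^ 'n) set)"
  by (simp add: perm_matrices_def finite_permutations)

lemma perm_matrices_nonempty: "(perm_matrices :: (real ^ 'n ^ 'n) set) \<noteq> {}"
  unfolding perm_matrices_def using permutes_id[of UNIV] by blast

definition frobenius_sq :: "real ^ 'n ^ 'n \<Rightarrow> real" where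
  "frobenius_sq M = (\<Sum>i\<in>UNIV. \<Sum>j\<in>UNIV. (M $ i $ j)\<^sup>2)"

definition erdos_matrix :: "real ^ 'n ^ 'n \<Rightarrow> bool" where
  "erdos_matrix E \<longleftrightarrow> bistochastic E \<and> maxtrace E = frobenius_sq E"

definition skel :: "real ^ 'n ^ 'n \<Rightarrow> real ^ 'n ^ 'n" where
  "skel M = (\<chi> i j. if M $ i $ j \<noteq> 0 then 1 else 0)"

definition zero_one_matrix :: "real ^ 'n ^ 'n \<Rightarrow> bool" where
  "zero_one_matrix S \<longleftrightarrow> (\<forall>i j. S $ i $ j = 0 \<or> S $ i $ j = 1)"

text \<open>The order on 0/1 matrices; it is only meant to be applied to such matrices.\<close>

definition zero_one_le :: "real ^ 'n ^ 'n \<Rightarrow> real ^ 'n ^ 'n \<Rightarrow> bool" where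
  "zero_one_le S1 S2 \<longleftrightarrow> zero_one_matrix (S2 - S1)"

definition zero_one_less :: "real ^ 'n ^ 'n \<Rightarrow> real ^ 'n ^ 'n \<Rightarrow> bool" where
  "zero_one_less S1 S2 \<longleftrightarrow> zero_one_le S1 S2 \<and> S1 \<noteq> S2"

lemma zero_one_matrix_skel: "zero_one_matrix (skel M)"
  by (simp add: zero_one_matrix_def skel_def)

end

(* Write m = maxtrace E2 = E2 \<bullet> E2, where \<bullet> is the Frobenius inner product. By Birkhoff's theorem
   B \<bullet> E2 \<le> m for every bistochastic B. If E1 vanishes wherever E2 does, then
   B = E2 + t (E2 - E1) is bistochastic for small t > 0, whence E1 \<bullet> E2 \<ge> m. Expanding the square,
   0 \<le> (E1 - E2) \<bullet> (E1 - E2) = maxtrace E1 - 2 (E1 \<bullet> E2) + m \<le> maxtrace E1 - maxtrace E2,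
   and the left side is positive unless E1 = E2. *)
theory Submission
  imports Defs
begin

section \<open>Hall's marriage theorem\<close>

text \<open>Rado's argument: a family with a member having two distinct elements stays a Hall family
  after one of the two is removed, by submodularity of \<open>J \<mapsto> card (\<Union>(A ` J))\<close>.\<close>

theorem hall_marriage:
  fixes A :: "'a \<Rightarrow> 'b set"
  assumes "finite I" and "\<And>i. i \<in> I \<Longrightarrow> finite (A i)"
    and "\<And>J. J \<subseteq> I \<Longrightarrow> card J \<le> card (\<Union>(A ` J))"
  shows "\<exists>f. (\<forall>i\<in>I. f i \<in> A i) \<and> inj_on f I"
  using assms(2,3)
proof (induction "\<Sum>i\<in>I. card (A i)" arbitrary: A rule: less_induct)
  case less
  note fin = less.prems(1) and hall = less.prems(2)
  show ?case
  proof (cases "\<exists>i\<in>I. \<exists>x\<in>A i. \<exists>y\<in>A i. x \<noteq> y")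
    \<comment> \<open>Hall's condition for \<open>{i}\<close> excludes the empty set, so every
      member is a singleton here; the condition for pairs then makes these singletons pairwise
      different.\<close>
    case False
    have ne: "\<exists>x. x \<in> A i" if "i \<in> I" for i
    proof (rule ccontr)
      assume "\<nexists>x. x \<in> A i"
      then have "A i = {}" by blast
      with hall[of "{i}"] that show False by simp
    qed
    define f where "f i = (SOME x. x \<in> A i)" for i
    have fA: "f i \<in> A i" if "i \<in> I" for i
      unfolding f_def using ne[OF that] by (rule someI_ex)
    have "inj_on f I"
    proof (rule inj_onI, rule ccontr)
      fix i j assume ij: "i \<in> I" "j \<in> I" "f i = f j" "i \<noteq> j"
      have "A k \<subseteq> {f k}" if "k \<in> I" for k
        using False fA[OF that] that by blast
      then have "A i \<subseteq> {f i}" "A j \<subseteq> {f i}"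
        using ij by metis+
      then have "\<Union>(A ` {i, j}) \<subseteq> {f i}" by simp
      then have "card (\<Union>(A ` {i, j})) \<le> card {f i}"
        by (intro card_mono) simp_all
      with hall[of "{i, j}"] ij show False by simp
    qed
    with fA show ?thesis by blast
  next
    case True
    then obtain i x y where i: "i \<in> I" and xy: "x \<in> A i" "y \<in> A i" "x \<noteq> y" by blast
    \<comment> \<open>If \<open>A\<close> has no injective choice, neither does the smaller family
      \<open>B\<close>, so by induction \<open>B\<close> violates Hall's condition. A violating set
      must contain \<open>i\<close>, since \<open>B\<close> and \<open>A\<close> agree elsewhere;
      taking \<open>i\<close> out of it yields \<open>J\<close> and turns the strict inequality into
      a weak one.\<close>
    have shrink: "\<exists>J. J \<subseteq> I - {i} \<and> card (\<Union>(A ` J) \<union> (A i - {z})) \<le> card J"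
      if z: "z \<in> A i" and no: "\<nexists>f. (\<forall>i\<in>I. f i \<in> A i) \<and> inj_on f I" for z
    proof -
      define B where "B = A(i := A i - {z})"
      have "(\<Sum>k\<in>I. card (B k)) < (\<Sum>k\<in>I. card (A k))"
      proof (rule sum_strict_mono_ex1)
        show "\<forall>k\<in>I. card (B k) \<le> card (A k)"
          using fin by (auto simp: B_def intro!: card_mono)
        show "\<exists>k\<in>I. card (B k) < card (A k)"
          using i card_Diff1_less[OF fin[OF i] z] by (intro bexI[of _ i]) (simp_all only: B_def fun_upd_same)
      qed (fact \<open>finite I\<close>)
      moreover have BA: "B k \<subseteq> A k" for k by (auto simp: B_def)
      moreover have "\<nexists>f. (\<forall>i\<in>I. f i \<in> B i) \<and> inj_on f I"
        using no BA by blast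
      moreover have "finite (B k)" if "k \<in> I" for k
        using BA fin[OF that] by (rule finite_subset)
      ultimately obtain J where J: "J \<subseteq> I" "card (\<Union>(B ` J)) < card J"
        using less.hyps[of B] not_le by blast
      have "i \<in> J"
      proof (rule ccontr)
        assume "i \<notin> J"
        then have "\<Union>(B ` J) = \<Union>(A ` J)" by (auto simp: B_def)
        with J hall[of J] show False by simp
      qed
      moreover have "\<Union>(A ` (J - {i})) \<union> (A i - {z}) = \<Union>(B ` J)"
        using \<open>i \<in> J\<close> by (auto simp: B_def)
      moreover have "card J = Suc (card (J - {i}))"
        using \<open>i \<in> J\<close> J(1) \<open>finite I\<close> by (metis card.remove finite_subset)
      ultimately show ?thesis using J by (intro exI[of _ "J - {i}"]) auto
    qed
    show ?thesis
    proof (rule ccontr)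
      assume no: "\<not> ?thesis"
      obtain J where J: "J \<subseteq> I - {i}" "card (\<Union>(A ` J) \<union> (A i - {x})) \<le> card J"
        using shrink[OF xy(1) no] by blast
      obtain K where K: "K \<subseteq> I - {i}" "card (\<Union>(A ` K) \<union> (A i - {y})) \<le> card K"
        using shrink[OF xy(2) no] by blast
      let ?X = "\<Union>(A ` J) \<union> (A i - {x})" and ?Y = "\<Union>(A ` K) \<union> (A i - {y})"
      have finJK: "finite J" "finite K"
        using J(1) K(1) \<open>finite I\<close> finite_subset by blast+
      then have finXY: "finite ?X" "finite ?Y"
        using J(1) K(1) fin i by auto
      \<comment> \<open>Since x and y differ, \<open>A i - {x}\<close> and \<open>A i - {y}\<close>
        together restore all of \<open>A i\<close>.\<close>
      have "?X \<union> ?Y = \<Union>(A ` insert i (J \<union> K))"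
        using xy by auto
      moreover have "card (insert i (J \<union> K)) = Suc (card (J \<union> K))"
        using J(1) K(1) finJK by (subst card_insert_disjoint) auto
      ultimately have U: "Suc (card (J \<union> K)) \<le> card (?X \<union> ?Y)"
        using hall[of "insert i (J \<union> K)"] J(1) K(1) i
        by (metis Diff_subset Un_least insert_subset subset_trans)
      have "card (J \<inter> K) \<le> card (\<Union>(A ` (J \<inter> K)))"
        using hall[of "J \<inter> K"] J(1) by auto
      also have "\<dots> \<le> card (?X \<inter> ?Y)"
        using finXY by (intro card_mono) auto
      finally have "card (J \<inter> K) \<le> card (?X \<inter> ?Y)" .
      \<comment> \<open>Inclusion-exclusion gives |X| + |Y| = |X \<union> Y| + |X \<inter> Y| \<ge>
        |J \<union> K| + 1 + |J \<inter> K| = |J| + |K| + 1, whereas |X| \<le> |J| and |Y| \<le>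
        |K|.\<close>
      with U J(2) K(2) card_Un_Int[OF finXY] card_Un_Int[OF finJK] show False by linarith
    qed
  qed
qed

section \<open>Traces as inner products, and permutation matrices\<close>

lemma sigma_trace_eq_inner:
  fixes S M :: "real ^ 'n ^ 'n"
  shows "sigma_trace S M = S \<bullet> M"
  unfolding sigma_trace_def trace_def matrix_matrix_mult_def transpose_def inner_vec_def
  by (simp, rule sum.swap)

lemma frobenius_sq_eq_inner:
  fixes M :: "real ^ 'n ^ 'n"
  shows "frobenius_sq M = M \<bullet> M"
  unfolding frobenius_sq_def inner_vec_def by (simp add: power2_eq_square)

lemma perm_matrix_inner_le_maxtrace:
  fixes M :: "real ^ 'n ^ 'n"
  assumes "p permutes UNIV"
  shows "perm_matrix p \<bullet> M \<le> maxtrace M"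
  unfolding maxtrace_def
  by (rule Max_ge) (use assms in \<open>auto simp: finite_perm_matrices perm_matrices_def
      simp flip: sigma_trace_eq_inner\<close>)

lemma perm_matrix_row_sum: "(\<Sum>j\<in>UNIV. perm_matrix p $ i $ j) = 1"
  by (simp add: perm_matrix_def)

lemma perm_matrix_column_sum:
  assumes "p permutes UNIV"
  shows "(\<Sum>i\<in>UNIV. perm_matrix p $ i $ j) = 1"
proof -
  have "j = p i \<longleftrightarrow> i = inv p j" for i
    using permutes_inverses[OF assms] by metis
  then show ?thesis by (simp add: perm_matrix_def)
qed

section \<open>Birkhoff's theorem in the form of an inequality\<close>

text \<open>Hall's condition holds by double counting: the rows in \<open>J\<close> carry total mass
  s |J|, all of it inside the columns of \<open>?N\<close>, and each column carries only s.\<close>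

lemma permutation_in_support:
  fixes F :: "real ^ 'n ^ 'n"
  assumes nonneg: "\<And>i j. 0 \<le> F $ i $ j" and "0 < s"
    and row: "\<And>i. (\<Sum>j\<in>UNIV. F $ i $ j) = s"
    and col: "\<And>j. (\<Sum>i\<in>UNIV. F $ i $ j) = s"
  obtains p where "p permutes UNIV" "\<And>i. 0 < F $ i $ p i"
proof -
  define A where "A i = {j. 0 < F $ i $ j}" for i
  have "card J \<le> card (\<Union>(A ` J))" for J
  proof -
    let ?N = "\<Union>(A ` J)"
    have "s * card J = (\<Sum>i\<in>J. \<Sum>j\<in>UNIV. F $ i $ j)"
      by (simp add: row)
    also have "\<dots> = (\<Sum>i\<in>J. \<Sum>j\<in>?N. F $ i $ j)"
    proof (rule sum.cong[OF refl])
      fix i assume "i \<in> J"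
      then have "\<forall>j \<in> UNIV - ?N. F $ i $ j = 0"
        using nonneg by (auto simp: A_def not_less intro: order.antisym)
      then show "(\<Sum>j\<in>UNIV. F $ i $ j) = (\<Sum>j\<in>?N. F $ i $ j)"
        by (intro sum.mono_neutral_right) auto
    qed
    also have "\<dots> = (\<Sum>j\<in>?N. \<Sum>i\<in>J. F $ i $ j)"
      by (rule sum.swap)
    also have "\<dots> \<le> (\<Sum>j\<in>?N. \<Sum>i\<in>UNIV. F $ i $ j)"
      by (intro sum_mono sum_mono2) (auto simp: nonneg)
    also have "\<dots> = s * card ?N"
      by (simp add: col)
    finally show ?thesis using \<open>0 < s\<close> by simp
  qed
  then obtain p where p: "\<And>i. p i \<in> A i" "inj p"
    using hall_marriage[of UNIV A] by auto
  have "p permutes UNIV"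
    using p(2) by (intro bij_imp_permutes) (auto simp: bij_def finite_UNIV_inj_surj)
  with p(1) that show ?thesis by (auto simp: A_def)
qed

text \<open>Birkhoff's greedy decomposition, by induction on the number of nonzero entries: a
  multiple of a permutation matrix inside the support is split off. The line sum s is left general
  because the remainder no longer has line sums 1.\<close>

lemma inner_le_maxtrace:
  fixes F M :: "real ^ 'n ^ 'n"
  assumes "\<And>i j. 0 \<le> F $ i $ j"
    and "\<And>i. (\<Sum>j\<in>UNIV. F $ i $ j) = s"
    and "\<And>j. (\<Sum>i\<in>UNIV. F $ i $ j) = s"
  shows "F \<bullet> M \<le> s * maxtrace M"
  using assms
proof (induction "card {(i, j). F $ i $ j \<noteq> 0}" arbitrary: F s rule: less_induct)
  case less
  note nonneg = less.prems(1) and row = less.prems(2) and col = less.prems(3)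
  \<comment> \<open>\<open>undefined\<close> serves only as some row index; any row would
    do.\<close>
  have "0 \<le> s"
    using row[of undefined] sum_nonneg[of UNIV "\<lambda>j. F $ undefined $ j"] nonneg by simp
  then consider "s = 0" | "0 < s" by fastforce
  then show ?case
  proof cases
    case 1
    then have "F $ i $ j = 0" for i j
      using row[of i] nonneg sum_nonneg_eq_0_iff[of UNIV "\<lambda>j. F $ i $ j"] by simp
    then have "F = 0" by (simp add: vec_eq_iff)
    with 1 show ?thesis by simp
  next
    case 2
    obtain p where p: "p permutes UNIV" "\<And>i. 0 < F $ i $ p i"
      using permutation_in_support[of F s] nonneg 2 row col by metis
    \<comment> \<open>The least entry along \<open>p\<close> is the largest multiple that keeps
      \<open>G\<close> nonnegative, and subtracting it kills the entry at (k, p k).\<close>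
    define l where "l = Min (range (\<lambda>i. F $ i $ p i))"
    have l_le: "l \<le> F $ i $ p i" for i
      unfolding l_def by (rule Min_le) auto
    have "l \<in> range (\<lambda>i. F $ i $ p i)"
      unfolding l_def by (rule Min_in) auto
    then obtain k where k: "l = F $ k $ p k" by blast
    define G where "G = F - l *\<^sub>R perm_matrix p"
    have G: "G $ i $ j = F $ i $ j - (if j = p i then l else 0)" for i j
      by (simp add: G_def perm_matrix_def)
    have "0 < l" using k p(2) by simp
    have "G \<bullet> M \<le> (s - l) * maxtrace M"
    proof (rule less.hyps)
      have "{(i, j). G $ i $ j \<noteq> 0} \<subset> {(i, j). F $ i $ j \<noteq> 0}"
      proof
        show "{(i, j). G $ i $ j \<noteq> 0} \<subseteq> {(i, j). F $ i $ j \<noteq> 0}"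
          using p(2) by (auto simp: G less_imp_neq[symmetric] split: if_splits)
        have "(k, p k) \<in> {(i, j). F $ i $ j \<noteq> 0} - {(i, j). G $ i $ j \<noteq> 0}"
          using k \<open>0 < l\<close> by (simp add: G)
        then show "{(i, j). G $ i $ j \<noteq> 0} \<noteq> {(i, j). F $ i $ j \<noteq> 0}" by blast
      qed
      then show "card {(i, j). G $ i $ j \<noteq> 0} < card {(i, j). F $ i $ j \<noteq> 0}"
        by (intro psubset_card_mono) auto
      show "0 \<le> G $ i $ j" for i j
        using nonneg l_le by (simp add: G)
      show "(\<Sum>j\<in>UNIV. G $ i $ j) = s - l" for i
        using row[of i] perm_matrix_row_sum[of p i]
        by (simp add: G_def sum_subtractf flip: sum_distrib_left)
      show "(\<Sum>i\<in>UNIV. G $ i $ j) = s - l" for j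
        using col[of j] perm_matrix_column_sum[OF p(1), of j]
        by (simp add: G_def sum_subtractf flip: sum_distrib_left)
    qed
    moreover have "F \<bullet> M = G \<bullet> M + l * (perm_matrix p \<bullet> M)"
      by (simp add: G_def inner_diff_left)
    moreover have "l * (perm_matrix p \<bullet> M) \<le> l * maxtrace M"
      using perm_matrix_inner_le_maxtrace[OF p(1), of M] \<open>0 < l\<close> by simp
    ultimately show ?thesis by (simp add: algebra_simps)
  qed
qed

section \<open>Comparing two Erdos matrices\<close>

text \<open>The linear functional X \<mapsto> X \<bullet> E attains its maximum over bistochastic
  matrices at \<open>E\<close>. The support condition lets the segment from \<open>B\<close> to
  \<open>E\<close> be prolonged beyond \<open>E\<close>, so the functional cannot be smaller at
  \<open>B\<close>.\<close>

lemma maxtrace_le_inner_of_support_subset: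
  fixes B E :: "real ^ 'n ^ 'n"
  assumes "erdos_matrix E" "bistochastic B"
    and supp: "\<And>i j. E $ i $ j = 0 \<Longrightarrow> B $ i $ j = 0"
  shows "maxtrace E \<le> B \<bullet> E"
proof -
  have E: "bistochastic E" "E \<bullet> E = maxtrace E"
    using assms(1) by (auto simp: erdos_matrix_def frobenius_sq_eq_inner)
  define V where "V = {E $ i $ j |i j. E $ i $ j \<noteq> 0}"
  have "V = (\<lambda>(i, j). E $ i $ j) ` {(i, j). E $ i $ j \<noteq> 0}" by (auto simp: V_def)
  then have "finite (insert 1 V)" by simp
  \<comment> \<open>Any positive t below all nonzero entries of \<open>E\<close> works, since on the
    support E + t (E - B) \<ge> E - t B \<ge> E - t. The inserted 1 makes the set visibly
    nonempty.\<close>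
  define t where "t = Min (insert 1 V)"
  have "t \<in> insert 1 V"
    unfolding t_def by (rule Min_in) (use \<open>finite (insert 1 V)\<close> in auto)
  moreover have "\<forall>v \<in> V. 0 < v"
    using E(1) by (auto simp: V_def bistochastic_def order.not_eq_order_implies_strict)
  ultimately have "0 < t" by auto
  have t_le: "t \<le> E $ i $ j" if "E $ i $ j \<noteq> 0" for i j
    unfolding t_def by (rule Min_le) (use \<open>finite (insert 1 V)\<close> that in \<open>auto simp: V_def\<close>)
  define F where "F = E + t *\<^sub>R (E - B)"
  have "F \<bullet> E \<le> 1 * maxtrace E"
  proof (rule inner_le_maxtrace)
    show "0 \<le> F $ i $ j" for i j
    proof (cases "E $ i $ j = 0")
      case True
      then show ?thesis using supp by (simp add: F_def)
    next
      case False
      have "B $ i $ j \<le> 1" "0 \<le> E $ i $ j"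
        using assms(2) E(1) by (auto simp: bistochastic_def)
      then have "t * (B $ i $ j - E $ i $ j) \<le> t * 1"
        using \<open>0 < t\<close> by (intro mult_left_mono) auto
      with t_le[OF False] show ?thesis by (simp add: F_def algebra_simps)
    qed
    show "(\<Sum>j\<in>UNIV. F $ i $ j) = 1" "(\<Sum>j\<in>UNIV. F $ j $ i) = 1" for i
      using assms(2) E(1)
      by (simp_all add: F_def bistochastic_def sum.distrib sum_subtractf flip: sum_distrib_left)
  qed
  then have "t * (E \<bullet> E - B \<bullet> E) \<le> 0"
    using E(2) by (simp add: F_def inner_add_left inner_diff_left)
  with \<open>0 < t\<close> E(2) show ?thesis by (simp add: mult_le_0_iff)
qed

text \<open>Serves both claims: positive definiteness makes the bound strict for (a), and applying
  it in both directions gives (b).\<close>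

lemma maxtrace_diff_ge:
  fixes E1 E2 :: "real ^ 'n ^ 'n"
  assumes "erdos_matrix E1" "erdos_matrix E2"
    and "\<And>i j. E2 $ i $ j = 0 \<Longrightarrow> E1 $ i $ j = 0"
  shows "(E1 - E2) \<bullet> (E1 - E2) \<le> maxtrace E1 - maxtrace E2"
  using maxtrace_le_inner_of_support_subset[of E2 E1] assms
  by (simp add: erdos_matrix_def frobenius_sq_eq_inner inner_diff_left inner_diff_right
      inner_commute)

theorem theorem1p5:
  fixes E1 E2 :: "real ^ 'n ^ 'n"
  assumes "erdos_matrix E1" and "erdos_matrix E2"
  shows "(zero_one_less (skel E1) (skel E2) \<longrightarrow> maxtrace E1 > maxtrace E2) \<and>
         (skel E1 = skel E2 \<longrightarrow> E1 = E2)"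
proof (intro conjI impI)
  assume less: "zero_one_less (skel E1) (skel E2)"
  have "E1 $ i $ j = 0" if "E2 $ i $ j = 0" for i j
  proof (rule ccontr)
    assume "E1 $ i $ j \<noteq> 0"
    with that have "(skel E2 - skel E1) $ i $ j = -1" by (simp add: skel_def)
    moreover have "(skel E2 - skel E1) $ i $ j \<in> {0, 1}"
      using less unfolding zero_one_less_def zero_one_le_def zero_one_matrix_def by blast
    ultimately show False by simp
  qed
  then have "(E1 - E2) \<bullet> (E1 - E2) \<le> maxtrace E1 - maxtrace E2"
    using maxtrace_diff_ge assms by blast
  moreover have "E1 \<noteq> E2"
    using less by (auto simp: zero_one_less_def)
  then have "0 < (E1 - E2) \<bullet> (E1 - E2)" by simp
  ultimately show "maxtrace E1 > maxtrace E2" by linarith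
next
  assume "skel E1 = skel E2"
  then have "E1 $ i $ j = 0 \<longleftrightarrow> E2 $ i $ j = 0" for i j
    by (auto simp: skel_def vec_eq_iff split: if_splits)
  \<comment> \<open>The right-hand sides cancel when added, so both squared distances
    vanish.\<close>
  then have "(E1 - E2) \<bullet> (E1 - E2) \<le> maxtrace E1 - maxtrace E2"
    "(E2 - E1) \<bullet> (E2 - E1) \<le> maxtrace E2 - maxtrace E1"
    using maxtrace_diff_ge[of E1 E2] maxtrace_diff_ge[of E2 E1] assms by auto
  moreover have "0 \<le> (E2 - E1) \<bullet> (E2 - E1)" by simp
  ultimately have "\<not> 0 < (E1 - E2) \<bullet> (E1 - E2)" by linarith
  then show "E1 = E2" by (simp only: inner_gt_zero_iff) simp
qed

end
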